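(* Let $p$ be an odd prime, $\zeta=e^{2\pi i/p}$ and $s=\frac{p-1}{2}$. Let $M(p)$ be the $p\times p$ complex matrix whose $(j,k)$-entry is $\zeta^{j(k-j)}$, where $j,k$ run over $0,1,\dots,p-1$, and let $C(p)$ be its set of eigenvalues. Then $\lambda\in C(p)$ if and only if $$\lambda=\left(\frac{-2}{p}\right)g(1;p)\,\zeta^{-sa^2}$$ for some integer $a$ with $0\le a\le p-1$. In particular, $|C(p)|=\frac{p+1}{2}$.
   Context: $\left(\frac{\cdot}{p}\right)$ denotes the Legendre symbol, and $g(1;p)=\sum_{k=0}^{p-1}e^{2\pi i k^2/p}$ is the quadratic Gauss sum mod $p$. *)

theory Defs
  imports
    Complex_Main
    "HOL-Number_Theory.Residues"
    "Jordan_Normal_Form.Spectral_Radius"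
begin

definition zeta :: "nat \<Rightarrow> complex"
  where "zeta p = exp (2 * of_real pi * \<i> / of_nat p)"

definition gauss_sum_quad :: "nat \<Rightarrow> complex"
  where "gauss_sum_quad p = (\<Sum>k<p. exp (2 * of_real pi * \<i> * of_nat k ^ 2 / of_nat p))"

text \<open>The exponent \<open>j (k - j)\<close> may be negative, so it is an integer
  and \<open>powi\<close> is the power.\<close>

definition M_mat :: "nat \<Rightarrow> complex mat"
  where "M_mat p = mat p p (\<lambda>(j, k). zeta p powi (int j * (int k - int j)))"

abbreviation eigenvalue_set :: "nat \<Rightarrow> complex set"
  where "eigenvalue_set p \<equiv> spectrum (M_mat p)"

end

theory Submission
  imports Defs "HOL-Analysis.Complex_Transcendental"
begin

text \<open>
  Modulo \<open>p\<close> we have \<open>s \<equiv> -1/2\<close>. The chirps \<open>v\<^sub>b(k) = \<zeta>\<^bsup>s k\<^sup>2 + b k\<^esup>\<close> are right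
  eigenvectors of \<open>M(p)\<close> and their inverses are left eigenvectors: completing the square in the
  exponent gives the eigenvalue \<open>G \<zeta>\<^bsup>-s b\<^sup>2\<^esup>\<close> in both cases, where
  \<open>G = \<Sum>\<^sub>x \<zeta>\<^bsup>s x\<^sup>2\<^esup>\<close>. By Fourier inversion no nonzero vector is annihilated by all left
  eigenvectors, so there are no further eigenvalues. Since \<open>4 s \<equiv> -2\<close>, \<open>G\<close> is the Gauss sum
  with coefficient \<open>-2\<close>, which contributes the Legendre symbol. As \<open>G \<noteq> 0\<close>, the number of
  eigenvalues is the number of squares modulo \<open>p\<close>.
\<close>

section \<open>Complete sums over residues\<close>

lemma zeta_nonzero [simp]: "zeta p \<noteq> 0"
  by (simp add: zeta_def)

lemma zeta_power: "zeta p ^ n = exp (2 * of_real pi * \<i> * of_nat n / of_nat p)"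
  by (simp add: zeta_def mult_ac flip: exp_of_nat_mult)

lemma zeta_powi_eq_1_iff:
  assumes "p > 0"
  shows "zeta p powi n = 1 \<longleftrightarrow> int p dvd n"
proof -
  have root: "zeta p ^ k = 1 \<longleftrightarrow> p dvd k" for k
    unfolding zeta_power using complex_root_unity_eq_1[of p k] assms by simp
  have "zeta p powi n = 1 \<longleftrightarrow> zeta p ^ nat \<bar>n\<bar> = 1"
    by (auto simp: power_int_def power_inverse)
  also have "\<dots> \<longleftrightarrow> int p dvd n"
    by (simp add: root nat_dvd_iff int_dvd_int_iff [symmetric] del: int_dvd_int_iff)
  finally show ?thesis .
qed

lemma zeta_powi_eq_iff:
  assumes "p > 0"
  shows "zeta p powi a = zeta p powi b \<longleftrightarrow> [a = b] (mod int p)"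
proof -
  have "zeta p powi a = zeta p powi b \<longleftrightarrow> zeta p powi (a - b) = 1"
    by (simp add: power_int_diff)
  then show ?thesis
    by (simp add: zeta_powi_eq_1_iff assms cong_iff_dvd_diff)
qed

text \<open>An injective map of residue classes permutes them, because there are finitely many. This
  provides every change of variable below: shifts, and multiplication by a unit modulo
  \<open>p\<close>.\<close>

lemma sum_residues_reindex:
  fixes f :: "int \<Rightarrow> 'a::comm_monoid_add"
  assumes "p > 0"
    and per: "\<And>x. f (x mod int p) = f x"
    and inj: "\<And>x y. [h x = h y] (mod int p) \<Longrightarrow> [x = y] (mod int p)"
  shows "(\<Sum>x\<in>{0..<int p}. f (h x)) = (\<Sum>x\<in>{0..<int p}. f x)"
proof -
  let ?R = "{0..<int p}"
  have inj': "inj_on (\<lambda>x. h x mod int p) ?R"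
    by (rule inj_onI, drule inj[unfolded cong_def]) simp
  moreover have "(\<lambda>x. h x mod int p) ` ?R \<subseteq> ?R"
    using assms(1) by auto
  ultimately have "(\<lambda>x. h x mod int p) ` ?R = ?R"
    by (intro endo_inj_surj) auto
  then have "(\<Sum>x\<in>?R. f x) = (\<Sum>x\<in>?R. f (h x mod int p))"
    using sum.reindex[OF inj', of f] by simp
  then show ?thesis
    by (simp add: per)
qed

lemma sum_lessThan_int: "(\<Sum>k<p. f (int k)) = (\<Sum>x\<in>{0..<int p}. f x)"
  by (rule sum.reindex_bij_witness[of _ nat int]) auto

text \<open>Orthogonality of additive characters. Shifting \<open>x\<close> by 1 permutes the
  residues but multiplies the sum by \<open>zeta p powi k\<close>, so the sum vanishes unless that
  factor is 1.\<close>

lemma sum_zeta_powi: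
  assumes "p > 0"
  shows "(\<Sum>x\<in>{0..<int p}. zeta p powi (k * x)) = (if int p dvd k then of_nat p else 0)"
proof (cases "int p dvd k")
  case True
  then have "zeta p powi (k * x) = 1" for x
    by (simp add: zeta_powi_eq_1_iff assms)
  then show ?thesis
    using True by simp
next
  case False
  let ?S = "\<Sum>x\<in>{0..<int p}. zeta p powi (k * x)"
  have "?S = (\<Sum>x\<in>{0..<int p}. zeta p powi (k * (x + 1)))"
  proof (rule sum_residues_reindex[symmetric, OF assms])
    show "zeta p powi (k * (x mod int p)) = zeta p powi (k * x)" for x
      by (simp add: assms zeta_powi_eq_iff cong_mult)
  qed (simp add: cong_add_rcancel)
  also have "\<dots> = zeta p powi k * ?S"
    by (simp add: distrib_left power_int_add sum_distrib_left mult.commute)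
  finally have "(1 - zeta p powi k) * ?S = 0"
    by (simp add: algebra_simps)
  then show ?thesis
    using False zeta_powi_eq_1_iff[OF assms] by auto
qed


section \<open>Quadratic Gauss sums\<close>

text \<open>The Gauss sum \<open>g(a;p)\<close>. The coefficient is an integer so that
  \<open>-2\<close> can be inserted directly.\<close>

definition gauss_sum_coeff :: "nat \<Rightarrow> int \<Rightarrow> complex"
  where "gauss_sum_coeff p a = (\<Sum>x\<in>{0..<int p}. zeta p powi (a * x\<^sup>2))"

lemma gauss_sum_coeff_1: "gauss_sum_coeff p 1 = gauss_sum_quad p"
proof -
  have "zeta p powi (1 * (int k)\<^sup>2) = exp (2 * of_real pi * \<i> * of_nat k ^ 2 / of_nat p)" for k
    using zeta_power[of p "k\<^sup>2"] by (simp flip: of_nat_power)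
  then show ?thesis
    unfolding gauss_sum_coeff_def gauss_sum_quad_def
    by (simp flip: sum_lessThan_int)
qed

lemma gauss_sum_coeff_cong:
  assumes "p > 0" "[a = b] (mod int p)"
  shows "gauss_sum_coeff p a = gauss_sum_coeff p b"
  unfolding gauss_sum_coeff_def
  by (intro sum.cong) (use assms in \<open>auto simp: zeta_powi_eq_iff cong_mult\<close>)

lemma prime_cong_mult_cancel:
  assumes "prime p" "\<not> int p dvd b" "[b * x = b * y] (mod int p)"
  shows "[x = y] (mod int p)"
proof -
  have "coprime b (int p)"
    using assms(1,2) prime_imp_coprime[of "int p" b] by (simp add: coprime_commute)
  then show ?thesis
    using assms(3) by (simp add: cong_mult_lcancel)
qed

text \<open>The factor \<open>b^2\<close> is absorbed by the substitution of \<open>b * x\<close>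
  for \<open>x\<close>, which permutes the residues.\<close>

lemma gauss_sum_coeff_mult_square:
  assumes "prime p" "\<not> int p dvd b"
  shows "gauss_sum_coeff p (a * b\<^sup>2) = gauss_sum_coeff p a"
proof -
  have p: "p > 0"
    using assms(1) prime_gt_0_nat by blast
  have "gauss_sum_coeff p (a * b\<^sup>2) = (\<Sum>x\<in>{0..<int p}. zeta p powi (a * (b * x)\<^sup>2))"
    by (simp add: gauss_sum_coeff_def power_mult_distrib mult_ac)
  also have "\<dots> = gauss_sum_coeff p a"
    unfolding gauss_sum_coeff_def
  proof (rule sum_residues_reindex[OF p])
    show "zeta p powi (a * (x mod int p)\<^sup>2) = zeta p powi (a * x\<^sup>2)" for x
      using p by (auto simp: zeta_powi_eq_iff intro!: cong_mult cong_pow)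
  qed (use prime_cong_mult_cancel assms in blast)
  finally show ?thesis .
qed

section \<open>Squares modulo an odd prime\<close>

lemma cong_square_iff:
  assumes "prime p"
  shows "[x\<^sup>2 = y\<^sup>2] (mod int p) \<longleftrightarrow> int p dvd x - y \<or> int p dvd x + y"
proof -
  have "x\<^sup>2 - y\<^sup>2 = (x - y) * (x + y)"
    by (simp add: power2_eq_square algebra_simps)
  then show ?thesis
    using assms by (simp add: cong_iff_dvd_diff prime_dvd_mult_iff)
qed

text \<open>In this range \<open>x - y\<close> and \<open>x + y\<close> have absolute value at most
  \<open>2 * s < p\<close>, so if \<open>p\<close> divides one of them, that one is 0; a zero sum
  forces \<open>x = y = 0\<close>.\<close>

lemma inj_on_square_mod:
  assumes "prime p" "p = 2 * s + 1"
  shows "inj_on (\<lambda>x. x\<^sup>2 mod int p) {0..int s}"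
proof (rule inj_onI)
  fix x y
  assume xy: "x \<in> {0..int s}" "y \<in> {0..int s}" "x\<^sup>2 mod int p = y\<^sup>2 mod int p"
  then have "int p dvd x - y \<or> int p dvd x + y"
    using cong_square_iff[OF assms(1)] by (simp add: cong_def)
  then show "x = y"
  proof
    assume "int p dvd x - y"
    then show ?thesis
      using xy assms(2) zdvd_imp_le[of "int p" "x - y"] zdvd_imp_le[of "int p" "y - x"]
        dvd_diff_commute[of "int p" x y] by force
  next
    assume "int p dvd x + y"
    then show ?thesis
      using xy assms(2) zdvd_imp_le[of "int p" "x + y"] by force
  qed
qed

text \<open>\<open>x\<close> and \<open>p - x\<close> have the same square, and one of them is at
  most \<open>s\<close>.\<close>

lemma square_mod_image:
  assumes "p = 2 * s + 1"
  shows "(\<lambda>x. x\<^sup>2 mod int p) ` {0..<int p} = (\<lambda>x. x\<^sup>2 mod int p) ` {0..int s}"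
proof (intro equalityI subsetI)
  fix t
  assume "t \<in> (\<lambda>x. x\<^sup>2 mod int p) ` {0..<int p}"
  then obtain x where x: "x \<in> {0..<int p}" "t = x\<^sup>2 mod int p"
    by blast
  have "(int p - x)\<^sup>2 - x\<^sup>2 = int p * (int p - 2 * x)"
    by (simp add: power2_eq_square algebra_simps)
  then have "(int p - x)\<^sup>2 mod int p = x\<^sup>2 mod int p"
    by (simp add: mod_eq_dvd_iff)
  moreover have "x \<in> {0..int s} \<or> int p - x \<in> {0..int s}"
    using x(1) assms by auto
  ultimately show "t \<in> (\<lambda>x. x\<^sup>2 mod int p) ` {0..int s}"
    using x(2) by (metis (mono_tags, lifting) image_eqI)
qed (use assms in auto)

section \<open>Gauss sums and the Legendre symbol\<close>

text \<open>The nonzero residues split into \<open>s\<close> squares \<open>t\<close>, where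
  \<open>g(t;p) = g(1;p)\<close>, and \<open>s\<close> products of \<open>a\<close> with squares,
  where \<open>g(t;p) = g(a;p)\<close>. The sum of \<open>g(t;p)\<close> over nonzero
  \<open>t\<close> is 0, so \<open>g(1;p) + g(a;p) = 0\<close>.\<close>

lemma gauss_sum_coeff_nonresidue:
  assumes p: "prime p" and ps: "p = 2 * s + 1" and nr: "\<not> QuadRes (int p) a"
  shows "gauss_sum_coeff p a = - gauss_sum_coeff p 1"
proof -
  let ?g = "gauss_sum_coeff p" and ?sq = "\<lambda>x. x\<^sup>2 mod int p"
  let ?asq = "\<lambda>x. a * x\<^sup>2 mod int p"
  have p0: "p > 0" and s0: "s > 0"
    using p ps prime_gt_1_nat[of p] by auto
  \<comment> \<open>Otherwise \<open>a\<close> would be congruent to the square of 0.\<close>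
  have a: "\<not> int p dvd a"
    using nr by (metis QuadRes_def cong_0_iff cong_sym power_zero_numeral)
  have nd: "\<not> int p dvd x" if "x \<in> {1..int s}" for x
    using that ps zdvd_imp_le[of "int p" x] by auto
  have inj: "inj_on ?sq {1..int s}"
    by (rule inj_on_subset[OF inj_on_square_mod[OF p ps]]) auto
  have inja: "inj_on ?asq {1..int s}"
  proof (rule inj_onI)
    fix x y
    assume xy: "x \<in> {1..int s}" "y \<in> {1..int s}" "?asq x = ?asq y"
    then have "?sq x = ?sq y"
      using prime_cong_mult_cancel[OF p a, of "x\<^sup>2" "y\<^sup>2"] by (simp only: cong_def)
    then show "x = y"
      using inj xy by (meson inj_onD)
  qed
  have disj: "?sq ` {1..int s} \<inter> ?asq ` {1..int s} = {}"
  proof -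
    \<comment> \<open>With \<open>z\<close> an inverse of \<open>y\<close>, a common value would
      make \<open>a\<close> the square of \<open>x * z\<close>.\<close>
    have False if xy: "x \<in> {1..int s}" "y \<in> {1..int s}" "?sq x = ?asq y" for x y
    proof -
      have "coprime y (int p)"
        using nd[OF xy(2)] p prime_imp_coprime[of "int p" y] by (simp add: coprime_commute)
      then obtain z where z: "[y * z = 1] (mod int p)"
        by (metis cong_solve_coprime_int)
      have "[x\<^sup>2 * z\<^sup>2 = a * y\<^sup>2 * z\<^sup>2] (mod int p)"
        using xy(3) by (intro cong_mult) (auto simp: cong_def)
      also have "a * y\<^sup>2 * z\<^sup>2 = a * (y * z)\<^sup>2"
        by (simp add: power_mult_distrib)
      also have "[a * (y * z)\<^sup>2 = a * 1\<^sup>2] (mod int p)"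
        by (intro cong_mult cong_pow z cong_refl)
      finally have "[(x * z)\<^sup>2 = a] (mod int p)"
        by (simp add: power_mult_distrib)
      then show False
        using nr by (auto simp: QuadRes_def)
    qed
    then show ?thesis
      by blast
  qed
  have cover: "?sq ` {1..int s} \<union> ?asq ` {1..int s} = {1..<int p}"
  \<comment> \<open>The two images are disjoint and have \<open>s\<close> elements each, which
    already exhausts the \<open>2 * s = p - 1\<close> nonzero residues.\<close>
  proof (rule card_subset_eq)
    have "t mod int p \<in> {1..<int p}" if "\<not> int p dvd t" for t
      using that p0 pos_mod_bound[of "int p" t] pos_mod_sign[of "int p" t]
      by (auto simp: dvd_eq_mod_eq_0 simp del: pos_mod_bound pos_mod_sign)
    then show "?sq ` {1..int s} \<union> ?asq ` {1..int s} \<subseteq> {1..<int p}"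
      using p a nd by (auto simp: prime_dvd_mult_iff prime_dvd_power_iff)
    show "card (?sq ` {1..int s} \<union> ?asq ` {1..int s}) = card {1..<int p}"
      unfolding card_Un_disjoint[OF finite_imageI finite_imageI disj, simplified]
        card_image[OF inj] card_image[OF inja] using ps by simp
  qed auto
  \<comment> \<open>The sum of \<open>g(t;p)\<close> over all \<open>t\<close> is evaluated by
    summing over \<open>t\<close> first: only \<open>x = 0\<close> survives, giving
    \<open>p\<close>. The term \<open>t = 0\<close> is itself \<open>p\<close>, so the others
    cancel.\<close>
  have "of_nat p = (\<Sum>x\<in>{0..<int p}. if x = 0 then of_nat p else (0::complex))"
    using p0 by simp
  also have "\<dots> = (\<Sum>x\<in>{0..<int p}. \<Sum>t\<in>{0..<int p}. zeta p powi (t * x\<^sup>2))"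
  proof (intro sum.cong refl)
    fix x
    assume "x \<in> {0..<int p}"
    then have "int p dvd x \<longleftrightarrow> x = 0"
      by (metis atLeastLessThan_iff dvd_0_right order_le_less zdvd_not_zless)
    then have "int p dvd x\<^sup>2 \<longleftrightarrow> x = 0"
      using p by (simp add: prime_dvd_power_iff)
    then show "(if x = 0 then of_nat p else 0) = (\<Sum>t\<in>{0..<int p}. zeta p powi (t * x\<^sup>2))"
      using sum_zeta_powi[OF p0, of "x\<^sup>2"] by (simp add: mult.commute)
  qed
  also have "\<dots> = (\<Sum>t\<in>{0..<int p}. ?g t)"
    unfolding gauss_sum_coeff_def by (rule sum.swap)
  also have "{0..<int p} = insert 0 {1..<int p}"
    using p0 by auto
  also have "(\<Sum>t\<in>insert 0 {1..<int p}. ?g t) = of_nat p + (\<Sum>t\<in>{1..<int p}. ?g t)"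
    by (simp add: gauss_sum_coeff_def)
  finally have "0 = (\<Sum>t\<in>{1..<int p}. ?g t)"
    by simp
  also have "\<dots> = (\<Sum>t\<in>?sq ` {1..int s}. ?g t) + (\<Sum>t\<in>?asq ` {1..int s}. ?g t)"
    unfolding cover[symmetric] by (rule sum.union_disjoint) (use disj in auto)
  also have "(\<Sum>t\<in>?sq ` {1..int s}. ?g t) = (\<Sum>x\<in>{1..int s}. ?g 1)"
    unfolding sum.reindex[OF inj] comp_def
  proof (intro sum.cong refl)
    fix x
    assume "x \<in> {1..int s}"
    then show "?g (?sq x) = ?g 1"
      using gauss_sum_coeff_cong[OF p0, of "?sq x" "1 * x\<^sup>2"]
        gauss_sum_coeff_mult_square[OF p nd, of x 1] by simp
  qed
  also have "(\<Sum>t\<in>?asq ` {1..int s}. ?g t) = (\<Sum>x\<in>{1..int s}. ?g a)"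
    unfolding sum.reindex[OF inja] comp_def
  proof (intro sum.cong refl)
    fix x
    assume "x \<in> {1..int s}"
    then show "?g (?asq x) = ?g a"
      using gauss_sum_coeff_cong[OF p0, of "?asq x" "a * x\<^sup>2"]
        gauss_sum_coeff_mult_square[OF p nd, of x a] by simp
  qed
  finally have "of_nat s * (?g 1 + ?g a) = 0"
    by (simp add: distrib_left)
  then show ?thesis
    using s0 by (simp add: eq_neg_iff_add_eq_0 add.commute)
qed

text \<open>A square coefficient is absorbed by substitution, and a nonresidue reverses the
  sign.\<close>

lemma gauss_sum_coeff_Legendre:
  assumes p: "prime p" and ps: "p = 2 * s + 1" and a: "\<not> int p dvd a"
  shows "gauss_sum_coeff p a = of_int (Legendre a (int p)) * gauss_sum_quad p"
proof (cases "QuadRes (int p) a")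
  case True
  then obtain b where b: "[b\<^sup>2 = a] (mod int p)"
    by (auto simp: QuadRes_def)
  then have "\<not> int p dvd b"
    using a by (metis cong_dvd_iff dvd_power zero_less_numeral dvd_trans)
  then have "gauss_sum_coeff p a = gauss_sum_coeff p 1"
    using gauss_sum_coeff_mult_square[OF p, of b 1] gauss_sum_coeff_cong[OF _ b]
      prime_gt_0_nat[OF p] by simp
  then show ?thesis
    using True a by (simp add: Legendre_def cong_0_iff gauss_sum_coeff_1)
next
  case False
  then show ?thesis
    using a gauss_sum_coeff_nonresidue[OF p ps]
    by (simp add: Legendre_def cong_0_iff gauss_sum_coeff_1)
qed

text \<open>Since \<open>2 s \<equiv> -1\<close> modulo \<open>p\<close>, we have
  \<open>s x\<^sup>2 + k x \<equiv> s (x - k)\<^sup>2 - s k\<^sup>2\<close>.\<close>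

lemma gauss_sum_complete_square:
  assumes ps: "p = 2 * s + 1"
  shows "(\<Sum>x\<in>{0..<int p}. zeta p powi (int s * x\<^sup>2 + k * x)) =
         gauss_sum_coeff p (int s) * zeta p powi (- (int s * k\<^sup>2))"
proof -
  have p0: "p > 0"
    using ps by simp
  have "zeta p powi (int s * x\<^sup>2 + k * x) =
        zeta p powi (int s * (x - k)\<^sup>2) * zeta p powi (- (int s * k\<^sup>2))" for x
  proof -
    have "int s * x\<^sup>2 + k * x - (int s * (x - k)\<^sup>2 + - (int s * k\<^sup>2)) = int p * (k * x)"
      by (simp add: ps power2_eq_square algebra_simps)
    then have "zeta p powi (int s * x\<^sup>2 + k * x) =
               zeta p powi (int s * (x - k)\<^sup>2 + - (int s * k\<^sup>2))"
      by (simp add: zeta_powi_eq_iff[OF p0] cong_iff_dvd_diff)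
    then show ?thesis
      by (simp only: power_int_add zeta_nonzero simp_thms)
  qed
  then have "(\<Sum>x\<in>{0..<int p}. zeta p powi (int s * x\<^sup>2 + k * x)) =
             (\<Sum>x\<in>{0..<int p}. zeta p powi (int s * (x - k)\<^sup>2)) * zeta p powi (- (int s * k\<^sup>2))"
    by (simp add: sum_distrib_right)
  also have "(\<Sum>x\<in>{0..<int p}. zeta p powi (int s * (x - k)\<^sup>2)) = gauss_sum_coeff p (int s)"
    unfolding gauss_sum_coeff_def
  proof (rule sum_residues_reindex[OF p0])
    show "zeta p powi (int s * (x mod int p)\<^sup>2) = zeta p powi (int s * x\<^sup>2)" for x
      using p0 by (auto simp: zeta_powi_eq_iff intro!: cong_mult cong_pow)
  qed (auto simp: cong_iff_dvd_diff)
  finally show ?thesis .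
qed

text \<open>If this sum vanished, completing the square would make the sums with linear term
  \<open>k * x\<close> vanish for every \<open>k\<close>. Their total over \<open>k\<close> is
  \<open>p\<close> by orthogonality.\<close>

lemma gauss_sum_coeff_nonzero:
  assumes ps: "p = 2 * s + 1"
  shows "gauss_sum_coeff p (int s) \<noteq> 0"
proof
  assume G: "gauss_sum_coeff p (int s) = 0"
  have p0: "p > 0"
    using ps by simp
  have "0 = (\<Sum>k\<in>{0..<int p}. \<Sum>x\<in>{0..<int p}. zeta p powi (int s * x\<^sup>2 + k * x))"
    by (simp add: gauss_sum_complete_square[OF ps] G)
  also have "\<dots> = (\<Sum>x\<in>{0..<int p}. zeta p powi (int s * x\<^sup>2) *
                    (\<Sum>k\<in>{0..<int p}. zeta p powi (x * k)))"
    by (subst sum.swap) (simp add: power_int_add sum_distrib_left mult.commute)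
  also have "\<dots> = (\<Sum>x\<in>{0..<int p}. if x = 0 then of_nat p else 0)"
    by (intro sum.cong refl) (use zdvd_imp_le[of "int p"] in \<open>force simp: sum_zeta_powi[OF p0]\<close>)
  also have "\<dots> = of_nat p"
    using p0 by simp
  finally show False
    using p0 by simp
qed


section \<open>The spectrum\<close>

lemma M_mat_mult_vec:
  assumes "v \<in> carrier_vec p" "j < p"
  shows "vec_index (M_mat p *\<^sub>v v) j =
         (\<Sum>k\<in>{0..<int p}. zeta p powi (int j * (k - int j)) * vec_index v (nat k))"
  using assms by (simp add: M_mat_def scalar_prod_def lessThan_atLeast0 flip: sum_lessThan_int)

section \<open>Chirps as right and left eigenvectors\<close>

text \<open>The factor \<open>zeta^(j*k)\<close> moves the frequency of the chirp from
  \<open>b\<close> to \<open>j + b\<close>. Completing the square leaves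
  \<open>-s*(j+b)^2 - j^2\<close>, whose quadratic part is that of the chirp again because
  \<open>-(s+1)\<close> is congruent to \<open>s\<close>.\<close>

lemma M_mat_right_eigenvector:
  assumes ps: "p = 2 * s + 1"
  shows "(\<Sum>k\<in>{0..<int p}. zeta p powi (j * (k - j)) * zeta p powi (int s * k\<^sup>2 + b * k)) =
         gauss_sum_coeff p (int s) * zeta p powi (- (int s * b\<^sup>2)) * zeta p powi (int s * j\<^sup>2 + b * j)"
proof -
  have p0: "p > 0"
    using ps by simp
  have "zeta p powi (j * (k - j)) * zeta p powi (int s * k\<^sup>2 + b * k) =
        zeta p powi (- j\<^sup>2) * zeta p powi (int s * k\<^sup>2 + (j + b) * k)" for k
    by (simp add: power2_eq_square algebra_simps flip: power_int_add)
  then have "(\<Sum>k\<in>{0..<int p}. zeta p powi (j * (k - j)) * zeta p powi (int s * k\<^sup>2 + b * k)) =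
      zeta p powi (- j\<^sup>2) * (\<Sum>k\<in>{0..<int p}. zeta p powi (int s * k\<^sup>2 + (j + b) * k))"
    by (simp add: sum_distrib_left)
  also have "\<dots> = gauss_sum_coeff p (int s) * zeta p powi (- j\<^sup>2 + - (int s * (j + b)\<^sup>2))"
    unfolding gauss_sum_complete_square[OF ps]
    by (simp only: power_int_add zeta_nonzero simp_thms mult_ac)
  also have "zeta p powi (- j\<^sup>2 + - (int s * (j + b)\<^sup>2)) =
             zeta p powi (- (int s * b\<^sup>2) + (int s * j\<^sup>2 + b * j))"
  proof -
    have "- j\<^sup>2 + - (int s * (j + b)\<^sup>2) - (- (int s * b\<^sup>2) + (int s * j\<^sup>2 + b * j)) =
          int p * (- j\<^sup>2 - b * j)"
      by (simp add: ps power2_eq_square algebra_simps)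
    then show ?thesis
      by (simp add: zeta_powi_eq_iff[OF p0] cong_iff_dvd_diff)
  qed
  also have "zeta p powi (- (int s * b\<^sup>2) + (int s * j\<^sup>2 + b * j)) =
             zeta p powi (- (int s * b\<^sup>2)) * zeta p powi (int s * j\<^sup>2 + b * j)"
    by (simp only: power_int_add zeta_nonzero simp_thms)
  finally show ?thesis
    by (simp add: mult.assoc)
qed

text \<open>The coefficient of \<open>j^2\<close> in the product is \<open>-s - 1\<close>, congruent
  to \<open>s\<close>, so the same completed square applies with linear coefficient
  \<open>k - b\<close>.\<close>

lemma M_mat_left_eigenvector:
  assumes ps: "p = 2 * s + 1"
  shows "(\<Sum>j\<in>{0..<int p}. zeta p powi (- (int s * j\<^sup>2) - b * j) * zeta p powi (j * (k - j))) =
         gauss_sum_coeff p (int s) * zeta p powi (- (int s * b\<^sup>2)) * zeta p powi (- (int s * k\<^sup>2) - b * k)"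
proof -
  have p0: "p > 0"
    using ps by simp
  have "zeta p powi (- (int s * j\<^sup>2) - b * j) * zeta p powi (j * (k - j)) =
        zeta p powi (int s * j\<^sup>2 + (k - b) * j)" for j
  proof -
    have "- (int s * j\<^sup>2) - b * j + j * (k - j) - (int s * j\<^sup>2 + (k - b) * j) = int p * (- j\<^sup>2)"
      by (simp add: ps power2_eq_square algebra_simps)
    then have "zeta p powi (- (int s * j\<^sup>2) - b * j + j * (k - j)) =
               zeta p powi (int s * j\<^sup>2 + (k - b) * j)"
      by (simp add: zeta_powi_eq_iff[OF p0] cong_iff_dvd_diff)
    then show ?thesis
      by (simp only: power_int_add zeta_nonzero simp_thms)
  qed
  then have "(\<Sum>j\<in>{0..<int p}. zeta p powi (- (int s * j\<^sup>2) - b * j) * zeta p powi (j * (k - j))) =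
             gauss_sum_coeff p (int s) * zeta p powi (- (int s * (k - b)\<^sup>2))"
    by (simp add: gauss_sum_complete_square[OF ps])
  also have "zeta p powi (- (int s * (k - b)\<^sup>2)) =
             zeta p powi (- (int s * b\<^sup>2) + (- (int s * k\<^sup>2) - b * k))"
  proof -
    have "- (int s * (k - b)\<^sup>2) - (- (int s * b\<^sup>2) + (- (int s * k\<^sup>2) - b * k)) = int p * (b * k)"
      by (simp add: ps power2_eq_square algebra_simps)
    then show ?thesis
      by (simp add: zeta_powi_eq_iff[OF p0] cong_iff_dvd_diff)
  qed
  also have "zeta p powi (- (int s * b\<^sup>2) + (- (int s * k\<^sup>2) - b * k)) =
             zeta p powi (- (int s * b\<^sup>2)) * zeta p powi (- (int s * k\<^sup>2) - b * k)"
    by (simp only: power_int_add zeta_nonzero simp_thms)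
  finally show ?thesis
    by (simp add: mult.assoc)
qed

text \<open>Fourier inversion: weighting the equation for \<open>b\<close> by
  \<open>zeta^(b*m)\<close> and summing over \<open>b\<close> isolates \<open>f m\<close>,
  multiplied by \<open>p\<close> and a nonzero power of \<open>zeta p\<close>.\<close>

lemma chirp_transform_injective:
  assumes p0: "p > 0"
    and zero: "\<And>b. b \<in> {0..<int p} \<Longrightarrow>
                (\<Sum>k\<in>{0..<int p}. zeta p powi (- (c * k\<^sup>2) - b * k) * f k) = 0"
    and m: "m \<in> {0..<int p}"
  shows "f m = 0"
proof -
  have "0 = (\<Sum>b\<in>{0..<int p}. zeta p powi (b * m) *
              (\<Sum>k\<in>{0..<int p}. zeta p powi (- (c * k\<^sup>2) - b * k) * f k))"
    by (simp add: zero)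
  also have "\<dots> = (\<Sum>k\<in>{0..<int p}. \<Sum>b\<in>{0..<int p}.
              zeta p powi (b * m) * (zeta p powi (- (c * k\<^sup>2) - b * k) * f k))"
    unfolding sum_distrib_left by (rule sum.swap)
  also have "\<dots> = (\<Sum>k\<in>{0..<int p}. zeta p powi (- (c * k\<^sup>2)) * f k *
              (\<Sum>b\<in>{0..<int p}. zeta p powi ((m - k) * b)))"
    unfolding sum_distrib_left
    by (intro sum.cong refl) (simp add: power_int_diff left_diff_distrib right_diff_distrib mult.commute)
  also have "\<dots> = (\<Sum>k\<in>{0..<int p}. if k = m then zeta p powi (- (c * k\<^sup>2)) * f k * of_nat p else 0)"
  proof (intro sum.cong refl)
    fix k
    assume "k \<in> {0..<int p}"
    then have "int p dvd m - k \<longleftrightarrow> k = m"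
      using m zdvd_imp_le[of "int p" "m - k"] zdvd_imp_le[of "int p" "k - m"]
        dvd_diff_commute[of "int p" m k] by force
    then show "zeta p powi (- (c * k\<^sup>2)) * f k * (\<Sum>b\<in>{0..<int p}. zeta p powi ((m - k) * b)) =
        (if k = m then zeta p powi (- (c * k\<^sup>2)) * f k * of_nat p else 0)"
      by (simp add: sum_zeta_powi[OF p0])
  qed
  also have "\<dots> = zeta p powi (- (c * m\<^sup>2)) * f m * of_nat p"
    using m by simp
  finally show ?thesis
    using p0 by simp
qed

section \<open>The eigenvalues and their number\<close>

lemma spectrum_M_mat:
  assumes ps: "p = 2 * s + 1"
  shows "spectrum (M_mat p) =
    (\<lambda>b. gauss_sum_coeff p (int s) * zeta p powi (- (int s * b\<^sup>2))) ` {0..<int p}"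
proof -
  have p0: "p > 0"
    using ps by simp
  have dim: "dim_row (M_mat p) = p"
    by (simp add: M_mat_def)
  let ?ev = "\<lambda>b. gauss_sum_coeff p (int s) * zeta p powi (- (int s * b\<^sup>2))"
  show ?thesis
  proof (intro equalityI subsetI)
    fix l
    assume "l \<in> ?ev ` {0..<int p}"
    then obtain b where l: "l = ?ev b"
      by blast
    let ?f = "\<lambda>k. zeta p powi (int s * k\<^sup>2 + b * k)"
    define v where "v = Matrix.vec p (\<lambda>k. ?f (int k))"
    have v: "v \<in> carrier_vec p"
      by (simp add: v_def)
    \<comment> \<open>The entry at 0 is \<open>zeta^0 = 1\<close>, so the chirp is a nonzero
      vector.\<close>
    have "vec_index v 0 \<noteq> 0"
      using p0 by (simp add: v_def)
    then have "v \<noteq> 0\<^sub>v p"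
      using p0 by auto
    moreover have "M_mat p *\<^sub>v v = l \<cdot>\<^sub>v v"
    proof (rule eq_vecI)
      fix j
      assume "j < dim_vec (l \<cdot>\<^sub>v v)"
      then have j: "j < p"
        by (simp add: v_def)
      have "vec_index (M_mat p *\<^sub>v v) j =
            (\<Sum>k\<in>{0..<int p}. zeta p powi (int j * (k - int j)) * ?f k)"
        unfolding M_mat_mult_vec[OF v j] by (intro sum.cong refl) (auto simp: v_def nat_less_iff)
      then show "vec_index (M_mat p *\<^sub>v v) j = vec_index (l \<cdot>\<^sub>v v) j"
        using j unfolding M_mat_right_eigenvector[OF ps] by (simp add: l v_def)
    qed (simp add: v_def dim)
    ultimately show "l \<in> spectrum (M_mat p)"
      using v by (auto simp: spectrum_def eigenvalue_def eigenvector_def dim)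
  next
    fix l
    assume "l \<in> spectrum (M_mat p)"
    then obtain v where v: "v \<in> carrier_vec p" "v \<noteq> 0\<^sub>v p" "M_mat p *\<^sub>v v = l \<cdot>\<^sub>v v"
      by (auto simp: spectrum_def eigenvalue_def eigenvector_def dim)
    let ?w = "\<lambda>b k. zeta p powi (- (int s * k\<^sup>2) - b * k)"
    let ?c = "\<lambda>b. \<Sum>k\<in>{0..<int p}. ?w b k * vec_index v (nat k)"
    \<comment> \<open>\<open>?c b\<close> pairs the left eigenvector of frequency \<open>b\<close>
      with \<open>v\<close>. If all pairings vanished, inversion would give
      \<open>v = 0\<close>.\<close>
    have "\<exists>b\<in>{0..<int p}. ?c b \<noteq> 0"
    proof (rule ccontr)
      assume "\<not> ?thesis"
      then have "vec_index v (nat m) = 0" if "m \<in> {0..<int p}" for m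
        using chirp_transform_injective[OF p0 _ that, of "int s" "\<lambda>k. vec_index v (nat k)"] by blast
      from this[of "int j" for j] have "v = 0\<^sub>v p"
        using v(1) by (intro eq_vecI) auto
      then show False
        using v(2) by simp
    qed
    then obtain b where b: "b \<in> {0..<int p}" "?c b \<noteq> 0"
      by blast
    have Mv: "l * vec_index v (nat j) =
              (\<Sum>k\<in>{0..<int p}. zeta p powi (j * (k - j)) * vec_index v (nat k))"
      if "j \<in> {0..<int p}" for j
      using M_mat_mult_vec[OF v(1), of "nat j"] v(1,3) that by (auto simp: nat_less_iff)
    \<comment> \<open>The product of \<open>?w b\<close>, the matrix and \<open>v\<close> is
      evaluated from both sides, giving \<open>l * ?c b = ?ev b * ?c b\<close>; the nonzero pairing
      then cancels.\<close>
    have "l * ?c b = (\<Sum>j\<in>{0..<int p}. ?w b j * (l * vec_index v (nat j)))"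
      by (simp add: sum_distrib_left mult_ac)
    also have "\<dots> = (\<Sum>j\<in>{0..<int p}. \<Sum>k\<in>{0..<int p}.
                 ?w b j * (zeta p powi (j * (k - j)) * vec_index v (nat k)))"
      by (simp add: Mv sum_distrib_left)
    also have "\<dots> = (\<Sum>k\<in>{0..<int p}. (\<Sum>j\<in>{0..<int p}. ?w b j * zeta p powi (j * (k - j))) *
                 vec_index v (nat k))"
      by (subst sum.swap) (simp add: sum_distrib_right mult.assoc)
    also have "\<dots> = ?ev b * ?c b"
      unfolding M_mat_left_eigenvector[OF ps] by (simp add: sum_distrib_left mult.assoc)
    finally show "l \<in> ?ev ` {0..<int p}"
      using b by auto
  qed
qed

text \<open>The eigenvalue depends only on \<open>b^2\<close> modulo \<open>p\<close>, and
  injectively so, because the Gauss sum is nonzero and \<open>s\<close> is a unit. The count is that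
  of the squares modulo \<open>p\<close>, zero included.\<close>

lemma card_spectrum_M_mat:
  assumes p: "prime p" and ps: "p = 2 * s + 1"
  shows "card (spectrum (M_mat p)) = s + 1"
proof -
  have p0: "p > 0" and s0: "s > 0"
    using p ps prime_gt_1_nat[of p] by auto
  let ?e = "\<lambda>t. gauss_sum_coeff p (int s) * zeta p powi (- (int s * t))"
  let ?sq = "\<lambda>x. x\<^sup>2 mod int p"
  have s: "\<not> int p dvd int s"
    using s0 ps by (auto dest: zdvd_imp_le)
  have e_eq: "?e t = ?e u \<longleftrightarrow> [t = u] (mod int p)" for t u
  proof -
    have "?e t = ?e u \<longleftrightarrow> [int s * t = int s * u] (mod int p)"
      using gauss_sum_coeff_nonzero[OF ps]
      by (simp add: zeta_powi_eq_iff[OF p0] cong_minus_minus_iff)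
    then show ?thesis
      using prime_cong_mult_cancel[OF p s] by (auto intro: cong_mult)
  qed
  have "spectrum (M_mat p) = (\<lambda>x. ?e (?sq x)) ` {0..<int p}"
    unfolding spectrum_M_mat[OF ps]
    by (intro image_cong refl) (simp only: e_eq, simp)
  also have "\<dots> = ?e ` ?sq ` {0..int s}"
    unfolding square_mod_image[OF ps, symmetric] by (simp add: image_image)
  also have "card \<dots> = card (?sq ` {0..int s})"
    by (intro card_image inj_onI) (auto simp only: e_eq cong_def mod_mod_trivial)
  also have "\<dots> = s + 1"
    by (simp add: card_image[OF inj_on_square_mod[OF p ps]])
  finally show ?thesis .
qed

theorem theorem4p4:
  fixes p s :: nat
  assumes "prime p" and "odd p"
    and "s = (p - 1) div 2"
  shows "(\<forall>l :: complex. l \<in> eigenvalue_set p \<longleftrightarrow>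
            (\<exists>a :: int. 0 \<le> a \<and> a \<le> int p - 1 \<and>
               l = of_int (Legendre (- 2) (int p)) * gauss_sum_quad p
                     * zeta p powi (- (int s * a ^ 2))))
         \<and> card (eigenvalue_set p) = (p + 1) div 2"
proof -
  have ps: "p = 2 * s + 1"
    using assms(2,3) by (auto elim: oddE)
  have p0: "p > 0" and s0: "s > 0"
    using assms(1) ps prime_gt_1_nat[of p] by auto
  have "\<not> int p dvd 2"
    using ps s0 by (auto dest: zdvd_imp_le)
  \<comment> \<open>The witness 2 comes from \<open>4*s + 2 = 2*p\<close>. Multiplying the
    coefficient \<open>s\<close> by the square 4 keeps the Gauss sum and turns the coefficient into
    \<open>-2\<close>.\<close>
  moreover have "[int s * 2\<^sup>2 = - 2] (mod int p)"
    unfolding cong_iff_dvd_diff by (rule dvdI[of _ _ 2]) (simp add: ps)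
  ultimately have "gauss_sum_coeff p (int s) = of_int (Legendre (- 2) (int p)) * gauss_sum_quad p"
    using gauss_sum_coeff_mult_square[OF assms(1), of 2 "int s"]
      gauss_sum_coeff_cong[OF p0, of "int s * 2\<^sup>2" "- 2"]
      gauss_sum_coeff_Legendre[OF assms(1) ps, of "- 2"] by simp
  then have "l \<in> eigenvalue_set p \<longleftrightarrow> (\<exists>a. 0 \<le> a \<and> a \<le> int p - 1 \<and>
      l = of_int (Legendre (- 2) (int p)) * gauss_sum_quad p * zeta p powi (- (int s * a\<^sup>2)))" for l
    unfolding spectrum_M_mat[OF ps] by (auto simp: image_iff)
  moreover have "card (eigenvalue_set p) = (p + 1) div 2"
    using card_spectrum_M_mat[OF assms(1) ps] ps by simp
  ultimately show ?thesis
    by blast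
qed

end
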